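(* If a cube $A\in\mathcal{C}^3_3(v,k,\lambda)$ exists and $k>1$, then $$\lambda(v-1)\le k(k-1)-1 .$$
   Context: A $v\times v\times v$ array is a function on $\{1,\dots,v\}^3$. A layer is a 2-dimensional subarray obtained by fixing one of the three coordinates. Two layers are parallel if they fix the same coordinate, to different values; their scalar product is the sum over all positions of the product of corresponding entries. $\mathcal{C}^3_3(v,k,\lambda)$ is the set of $v\times v\times v$ arrays over $\{0,1\}$ such that every layer (in each of the three directions) contains exactly $k$ ones and every two parallel layers have scalar product $\lambda$. *)

theory Defs
  imports Main "HOL-Library.FuncSet"
begin

text \<open>A \<open>v \<times> v \<times> v\<close> array over \<open>S\<close> is an extensional function on \<open>{1..v} \<times> {1..v} \<times> {1..v}\<close>.\<close>

definition arrays :: "nat \<Rightarrow> nat set \<Rightarrow> (nat \<times> nat \<times> nat \<Rightarrow> nat) set" where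
  "arrays v S = ({1..v} \<times> {1..v} \<times> {1..v}) \<rightarrow>\<^sub>E S"

datatype direction = Dir1 | Dir2 | Dir3

text \<open>\<open>layer d a A\<close> fixes the coordinate in direction \<open>d\<close> to \<open>a\<close>; the other two coordinates,
  in their original order, index the resulting 2-dimensional subarray.\<close>

fun layer :: "direction \<Rightarrow> nat \<Rightarrow> (nat \<times> nat \<times> nat \<Rightarrow> nat) \<Rightarrow> nat \<times> nat \<Rightarrow> nat" where
  "layer Dir1 a A (x, y) = A (a, x, y)"
| "layer Dir2 a A (x, y) = A (x, a, y)"
| "layer Dir3 a A (x, y) = A (x, y, a)"

definition num_ones :: "nat \<Rightarrow> (nat \<times> nat \<Rightarrow> nat) \<Rightarrow> nat" where
  "num_ones v L = card {p \<in> {1..v} \<times> {1..v}. L p = 1}"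

definition scalar_product :: "nat \<Rightarrow> (nat \<times> nat \<Rightarrow> nat) \<Rightarrow> (nat \<times> nat \<Rightarrow> nat) \<Rightarrow> nat" where
  "scalar_product v L M = (\<Sum>p \<in> {1..v} \<times> {1..v}. L p * M p)"

text \<open>The set \<open>\<C>\<^sup>3\<^sub>3(v, k, \<lambda>)\<close>.\<close>

definition cubes33 :: "nat \<Rightarrow> nat \<Rightarrow> nat \<Rightarrow> (nat \<times> nat \<times> nat \<Rightarrow> nat) set" where
  "cubes33 v k l = {A \<in> arrays v {0, 1}.
     (\<forall>d. \<forall>a\<in>{1..v}. num_ones v (layer d a A) = k) \<and>
     (\<forall>d. \<forall>a\<in>{1..v}. \<forall>b\<in>{1..v}. a \<noteq> b \<longrightarrow>
        scalar_product v (layer d a A) (layer d b A) = l)}"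

end

theory Submission
  imports Defs
begin

text \<open>Fix a position holding a one. The lines through it in directions 1 and 3 lie in a common
  layer of direction 2 and meet only there, so together they hold at most \<open>k + 1\<close> ones, counting
  that position twice. Summing over all ones bounds the number of ordered pairs of ones on a common
  line of direction 1 or 3, diagonal pairs included, by \<open>v k (k + 1)\<close>. Counted by scalar products
  this number is \<open>2 (v k + v (v - 1) \<lambda>)\<close>. Hence \<open>2 \<lambda> (v - 1) \<le> k (k - 1)\<close>, which is stronger than
  the claim.\<close>

lemma cubes33_values:
  assumes "A \<in> cubes33 v k l" and "p \<in> {1..v} \<times> {1..v}" and "a \<in> {1..v}"
  shows "layer d a A p \<in> {0, 1}"
proof -
  have "A \<in> ({1..v} \<times> {1..v} \<times> {1..v}) \<rightarrow> {0, 1}"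
    using assms(1) by (simp add: cubes33_def arrays_def PiE_def)
  then show ?thesis
    using assms(2,3) by (cases p; cases d) (auto simp: Pi_iff)
qed

lemma num_ones_eq_sum:
  assumes "\<And>p. p \<in> {1..v} \<times> {1..v} \<Longrightarrow> L p \<in> {0, 1}"
  shows "num_ones v L = (\<Sum>p \<in> {1..v} \<times> {1..v}. L p)"
proof -
  have "(\<Sum>p \<in> {1..v} \<times> {1..v}. L p) = (\<Sum>p \<in> {1..v} \<times> {1..v}. if L p = 1 then 1 else 0)"
    using assms by (intro sum.cong) auto
  also have "\<dots> = num_ones v L"
    unfolding num_ones_def by (simp flip: sum.inter_filter)
  finally show ?thesis by simp
qed

lemma scalar_product_self:
  assumes "\<And>p. p \<in> {1..v} \<times> {1..v} \<Longrightarrow> L p \<in> {0, 1}"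
  shows "scalar_product v L L = num_ones v L"
proof -
  have "scalar_product v L L = (\<Sum>p \<in> {1..v} \<times> {1..v}. L p)"
    unfolding scalar_product_def using assms by (intro sum.cong) auto
  then show ?thesis
    using num_ones_eq_sum[of v L, OF assms] by simp
qed

lemma cubes33_layer_sum:
  assumes "A \<in> cubes33 v k l" and "a \<in> {1..v}"
  shows "(\<Sum>p \<in> {1..v} \<times> {1..v}. layer d a A p) = k"
  using num_ones_eq_sum[of v "layer d a A"] cubes33_values[OF assms(1) _ assms(2)] assms
  by (auto simp: cubes33_def)

text \<open>The double sum counts ordered pairs of ones on a common line of direction
  \<open>d\<close>. Each of the \<open>v\<close> diagonal terms equals \<open>k\<close>, because
  entries 0 and 1 are their own squares; every other term is \<open>l\<close>.\<close>

lemma cubes33_scalar_product_sum: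
  assumes "A \<in> cubes33 v k l"
  shows "(\<Sum>a\<in>{1..v}. \<Sum>b\<in>{1..v}. scalar_product v (layer d a A) (layer d b A))
    = v * (k + (v - 1) * l)"
proof -
  have "(\<Sum>b\<in>{1..v}. scalar_product v (layer d a A) (layer d b A)) = k + (v - 1) * l"
    if a: "a \<in> {1..v}" for a
  proof -
    have "scalar_product v (layer d a A) (layer d a A) = k"
      using scalar_product_self[OF cubes33_values[OF assms _ a]] assms a
      by (auto simp: cubes33_def)
    moreover have "(\<Sum>b\<in>{1..v} - {a}. scalar_product v (layer d a A) (layer d b A))
        = (\<Sum>b\<in>{1..v} - {a}. l)"
      using assms a by (intro sum.cong) (auto simp: cubes33_def)
    ultimately show ?thesis
      using a by (simp add: sum.remove)
  qed
  then show ?thesis by simp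
qed

text \<open>Row \<open>i\<close> is kept whole, and every other row is at least its entry in column
  \<open>j\<close>. The cell \<open>(i, j)\<close>, lying on both lines, accounts for the extra
  \<open>f i j\<close>.\<close>

lemma sum_row_column_le:
  fixes f :: "'a \<Rightarrow> 'b \<Rightarrow> nat"
  assumes "finite I" "finite J" "i \<in> I" "j \<in> J"
  shows "(\<Sum>i'\<in>I. f i' j) + (\<Sum>j'\<in>J. f i j') \<le> (\<Sum>i'\<in>I. \<Sum>j'\<in>J. f i' j') + f i j"
proof -
  have "(\<Sum>i'\<in>I - {i}. f i' j) \<le> (\<Sum>i'\<in>I - {i}. \<Sum>j'\<in>J. f i' j')"
    using assms by (intro sum_mono member_le_sum) auto
  then show ?thesis
    using assms by (simp add: sum.remove[of I i])
qed

lemma cubes33_strong_bound: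
  assumes A: "A \<in> cubes33 v k l" and "v > 0"
  shows "2 * (k + (v - 1) * l) \<le> k * (k + 1)"
proof -
  let ?I = "{1..v}"
  have k2: "(\<Sum>x\<in>?I. \<Sum>z\<in>?I. A (x, y, z)) = k" if "y \<in> ?I" for y
    using cubes33_layer_sum[OF A that, of Dir2] by (simp add: sum.cartesian_product')
  \<comment> \<open>Weighting each one by the number of ones on its line of direction 1 counts
    ordered pairs on such lines; with \<open>b\<close> outside the sum over positions, the count
    becomes scalar products.\<close>
  have d1: "(\<Sum>x\<in>?I. \<Sum>y\<in>?I. \<Sum>z\<in>?I. A (x, y, z) * (\<Sum>b\<in>?I. A (b, y, z)))
      = v * (k + (v - 1) * l)"
  proof -
    have "(\<Sum>y\<in>?I. \<Sum>z\<in>?I. A (x, y, z) * (\<Sum>b\<in>?I. A (b, y, z)))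
        = (\<Sum>b\<in>?I. scalar_product v (layer Dir1 x A) (layer Dir1 b A))" for x
      unfolding scalar_product_def
      by (subst sum.swap) (simp add: sum.cartesian_product' sum_distrib_left)
    then show ?thesis
      using cubes33_scalar_product_sum[OF A, of Dir1] by simp
  qed
  have d3: "(\<Sum>x\<in>?I. \<Sum>y\<in>?I. \<Sum>z\<in>?I. A (x, y, z) * (\<Sum>c\<in>?I. A (x, y, c)))
      = v * (k + (v - 1) * l)"
  proof -
    have "(\<Sum>x\<in>?I. \<Sum>y\<in>?I. A (x, y, z) * (\<Sum>c\<in>?I. A (x, y, c)))
        = (\<Sum>c\<in>?I. scalar_product v (layer Dir3 z A) (layer Dir3 c A))" for z
      unfolding scalar_product_def
      by (subst sum.swap) (simp add: sum.cartesian_product' sum_distrib_left)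
    \<comment> \<open>Layers of direction 3 fix \<open>z\<close>, so \<open>z\<close> has to move
      outermost, first past \<open>y\<close>, then past \<open>x\<close>.\<close>
    moreover have "(\<Sum>x\<in>?I. \<Sum>y\<in>?I. \<Sum>z\<in>?I. A (x, y, z) * (\<Sum>c\<in>?I. A (x, y, c)))
        = (\<Sum>z\<in>?I. \<Sum>x\<in>?I. \<Sum>y\<in>?I. A (x, y, z) * (\<Sum>c\<in>?I. A (x, y, c)))"
      by (rule trans[OF sum.cong[OF refl sum.swap] sum.swap])
    ultimately show ?thesis
      using cubes33_scalar_product_sum[OF A, of Dir3] by simp
  qed
  have pt: "A (x, y, z) * ((\<Sum>b\<in>?I. A (b, y, z)) + (\<Sum>c\<in>?I. A (x, y, c)))
      \<le> A (x, y, z) * (k + 1)" if "x \<in> ?I" "y \<in> ?I" "z \<in> ?I" for x y z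
  proof -
    have "A (x, y, z) \<in> {0, 1}"
      using cubes33_values[OF A, of "(y, z)" x Dir1] that by simp
    moreover have "(\<Sum>b\<in>?I. A (b, y, z)) + (\<Sum>c\<in>?I. A (x, y, c)) \<le> k + A (x, y, z)"
      using sum_row_column_le[of ?I ?I x z "\<lambda>x z. A (x, y, z)"] k2 that by simp
    ultimately show ?thesis by auto
  qed
  have "v * (2 * (k + (v - 1) * l))
      = (\<Sum>x\<in>?I. \<Sum>y\<in>?I. \<Sum>z\<in>?I.
          A (x, y, z) * ((\<Sum>b\<in>?I. A (b, y, z)) + (\<Sum>c\<in>?I. A (x, y, c))))"
    using d1 d3 by (simp add: distrib_left sum.distrib)
  also have "\<dots> \<le> (\<Sum>x\<in>?I. \<Sum>y\<in>?I. \<Sum>z\<in>?I. A (x, y, z) * (k + 1))"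
    using pt by (intro sum_mono) auto
  \<comment> \<open>With \<open>y\<close> outermost, each inner double sum is a direction-2 layer,
    to which \<open>k2\<close> applies.\<close>
  also have "\<dots> = (\<Sum>y\<in>?I. \<Sum>x\<in>?I. \<Sum>z\<in>?I. A (x, y, z)) * (k + 1)"
    by (subst sum.swap) (simp only: sum_distrib_right)
  also have "\<dots> = v * (k * (k + 1))"
    using k2 by (simp add: distrib_left mult.assoc)
  finally show ?thesis
    using \<open>v > 0\<close> by simp
qed

theorem proposition2p3:
  fixes v k l :: nat and A :: "nat \<times> nat \<times> nat \<Rightarrow> nat"
  assumes "A \<in> cubes33 v k l"
    and "k > 1"
  shows "int l * (int v - 1) \<le> int k * (int k - 1) - 1"
proof -
  \<comment> \<open>This gives half of \<open>k * (k - 1)\<close> at most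
    \<open>k * (k - 1) - 1\<close>, which turns the strong bound into the claim.\<close>
  have k: "2 * 1 \<le> int k * (int k - 1)"
    using assms(2) by (intro mult_mono) auto
  show ?thesis
  \<comment> \<open>For \<open>v = 0\<close> the truncated \<open>v - 1\<close> differs from the
    integer one; there the left side is \<open>- int l\<close>, hence at most 0.\<close>
  proof (cases "v = 0")
    case True
    then show ?thesis using k by simp
  next
    case False
    then have "int (2 * (k + (v - 1) * l)) \<le> int (k * (k + 1))"
      using cubes33_strong_bound[OF assms(1)] by (simp only: of_nat_le_iff neq0_conv)
    moreover have "int (v - 1) = int v - 1"
      using False by simp
    ultimately have "2 * (int k + (int v - 1) * int l) \<le> int k * (int k + 1)"
      by (simp only: of_nat_mult of_nat_add of_nat_numeral of_nat_1)
    then have "2 * (int l * (int v - 1)) \<le> int k * (int k - 1)"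
      by (simp add: algebra_simps)
    then show ?thesis using k by simp
  qed
qed

end
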